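(* Let $k\ge2$, let $(x_n)_{n\in\mathbb{N}}\subseteq[0,1]$, let $G:[0,1]\to\mathbb{R}$ be an asymptotic distribution function of $(x_n)$ and let $(N_j)_{j\in\mathbb{N}}$ be a strictly increasing sequence of integers with $G(x)=\lim_{j\to\infty}\frac1{N_j}\#\{n\le N_j:0\le x_n\le x\}$ for all $x\in[0,1]$. Then: (i) If $G$ is not absolutely continuous, then $\lim_{j\to\infty}R_k(s,N_j)=\infty$ for all $s>0$. (ii) If $G$ is absolutely continuous with density $g$ (so $g=G'$ almost everywhere), then $$\limsup_{s\to\infty}\frac{\limsup_{j\to\infty}R_k(s,N_j)}{(2s)^{k-1}}\ \ge\ \int_0^1 g(x)^k\,dx.$$
   Context: $\|x\|$ denotes the distance of $x\in\mathbb{R}$ to the nearest integer. A function $G:[0,1]\to\mathbb{R}$ is an asymptotic distribution function of $(x_n)$ if there is a strictly increasing sequence of integers $(N_j)$ with $G(x)=\lim_{j}\frac1{N_j}\#\{n\le N_j:0\le x_n\le x\}$ for all $0\le x\le1$. For $s>0$ and $N\ge1$, $R_k(s,N)=\frac1N\#\{(i_1,\dots,i_k): i_1,\dots,i_k\le N \text{ pairwise distinct},\ \|x_{i_1}-x_{i_{r+1}}\|\le s/N \text{ for } 1\le r<k\}$. *)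

theory Defs
  imports "HOL-Analysis.Analysis"
begin

text \<open>
  Sequences are functions on \<^typ>\<open>nat\<close> of which only the terms with index \<open>n \<ge> 1\<close> are used;
  functions on \<open>[0,1]\<close> are total functions whose values outside \<open>[0,1]\<close> are never used.
\<close>

definition dist_nearest_int :: "real \<Rightarrow> real" where
  "dist_nearest_int t = infdist t \<int>"

definition distribution_function_along ::
    "(nat \<Rightarrow> real) \<Rightarrow> (nat \<Rightarrow> nat) \<Rightarrow> (real \<Rightarrow> real) \<Rightarrow> bool" where
  "distribution_function_along x N G \<longleftrightarrow>
     strict_mono N \<and>
     (\<forall>t\<in>{0..1}. (\<lambda>j. real (card {n \<in> {1..N j}. 0 \<le> x n \<and> x n \<le> t}) / real (N j))
                    \<longlonglongrightarrow> G t)"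

definition asymptotic_distribution_function :: "(nat \<Rightarrow> real) \<Rightarrow> (real \<Rightarrow> real) \<Rightarrow> bool" where
  "asymptotic_distribution_function x G \<longleftrightarrow> (\<exists>N. distribution_function_along x N G)"

text \<open>
  A tuple \<open>(i\<^sub>1, \<dots>, i\<^sub>k)\<close> is a list \<open>is\<close> of length \<open>k\<close>; as lists are indexed from \<open>0\<close>,
  \<open>i\<^sub>1\<close> is \<open>is ! 0\<close> and \<open>i\<^sub>r\<^sub>+\<^sub>1\<close> is \<open>is ! r\<close>.
\<close>

definition correlation :: "nat \<Rightarrow> (nat \<Rightarrow> real) \<Rightarrow> real \<Rightarrow> nat \<Rightarrow> real" where
  "correlation k x s N =
     real (card {is :: nat list. length is = k \<and> set is \<subseteq> {1..N} \<and> distinct is \<and>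
       (\<forall>r. 1 \<le> r \<and> r < k \<longrightarrow> dist_nearest_int (x (is ! 0) - x (is ! r)) \<le> s / real N)})
     / real N"

definition abs_continuous_on_interval :: "real \<Rightarrow> real \<Rightarrow> (real \<Rightarrow> real) \<Rightarrow> bool" where
  "abs_continuous_on_interval a b f \<longleftrightarrow>
     (\<forall>\<epsilon>>0. \<exists>\<delta>>0. \<forall>(m::nat) u v.
        (\<forall>i<m. a \<le> u i \<and> u i \<le> v i \<and> v i \<le> b) \<and>
        (\<forall>i<m. \<forall>j<m. i \<noteq> j \<longrightarrow> {u i<..<v i} \<inter> {u j<..<v j} = {}) \<and>
        (\<Sum>i<m. v i - u i) < \<delta>
        \<longrightarrow> (\<Sum>i<m. \<bar>f (v i) - f (u i)\<bar>) < \<epsilon>)"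

end

theory Submission
  imports Defs
begin

text \<open>
  Cut an interval into cells of length \<open>\<delta>\<close>, where the scale is \<open>\<delta> = s / N\<close>, and slide a window of
  \<open>L\<close> consecutive cells over it. A pair of points whose cells differ by \<open>d\<close> lies in \<open>L - d\<close> common
  windows and has distance at most \<open>l \<delta>\<close> for every \<open>l > d\<close>; hence the sum of the squared window
  counts is at most the number of close pairs at distance \<open>l \<delta>\<close>, summed over \<open>l \<le> L\<close>. This
  averaging over \<open>l\<close> produces the sharp factor \<open>2\<close> as \<open>L \<rightarrow> \<infinity>\<close>. Convexity, in the form of tangent
  lines of \<open>y \<mapsto> y\<^sup>2\<close> and of \<open>y \<mapsto> y ^ (k - 1)\<close>, turns this into lower bounds for \<open>k\<close>-tuples that are
  linear in the number of points of each interval, so they add up over disjoint intervals and pass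
  to the limit \<open>j \<rightarrow> \<infinity>\<close>.

  For (i), if \<open>R\<^sub>k\<close> stays bounded along a subsequence, the bound with \<open>L = 1\<close> and a steep tangent is
  precisely absolute continuity of \<open>G\<close>. For (ii), if \<open>limsup R\<^sub>k(s) \<le> c (2 s) ^ (k - 1)\<close> for all
  large \<open>s\<close>, then summing over \<open>s = l \<le> L\<close> with weights \<open>l ^ (2 - k)\<close> and letting \<open>L \<rightarrow> \<infinity>\<close> bounds by \<open>c\<close> the
  integral of the \<open>k\<close>-th power of the difference quotients of \<open>G\<close> over every uniform partition, and
  Fatou's lemma gives \<open>\<integral> g ^ k \<le> c\<close>.
\<close>


section \<open>Tangent-line bounds for powers and for counts of distinct tuples\<close>

text \<open>In the induction step, \<open>y\<close> times the tangent of degree \<open>Suc q\<close>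
  exceeds the tangent of the next degree by exactly
  \<open>real (Suc q) * Y ^ q * (y - Y)\<^sup>2\<close>.\<close>

lemma power_Suc_ge_tangent:
  fixes y Y :: real
  assumes "y \<ge> 0" "Y \<ge> 0"
  shows "Y ^ Suc q + real (Suc q) * Y ^ q * (y - Y) \<le> y ^ Suc q"
proof (induction q)
  case 0
  then show ?case by simp
next
  case (Suc q)
  have "0 \<le> real (Suc q) * Y ^ q * (y - Y)\<^sup>2"
    using assms by simp
  then have "Y ^ Suc (Suc q) + real (Suc (Suc q)) * Y ^ Suc q * (y - Y)
      \<le> y * (Y ^ Suc q + real (Suc q) * Y ^ q * (y - Y))"
    by (simp add: algebra_simps power2_eq_square)
  also have "\<dots> \<le> y * y ^ Suc q"
    using Suc assms by (intro mult_left_mono) auto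
  finally show ?case by simp
qed

text \<open>The count is a falling factorial whose \<open>q + 1\<close> factors are all at least
  \<open>card D - q\<close>, and the resulting power is replaced by its tangent at \<open>Y\<close>.
  Only this linearity in \<open>card D\<close> allows the bound to be summed over points.\<close>

lemma card_distinct_lists_ge:
  assumes "finite D" and "Y \<ge> 0"
  shows "Y ^ Suc q + real (Suc q) * Y ^ q * (real (card D) - real q - Y)
    \<le> real (card {xs. length xs = Suc q \<and> distinct xs \<and> set xs \<subseteq> D})"
proof (cases "Suc q \<le> card D")
  case True
  have "(card D - q) ^ Suc q = (\<Prod>i\<in>{card D - Suc q + 1..card D}. card D - q)"
    using True by simp
  also have "\<dots> \<le> \<Prod>{card D - Suc q + 1..card D}"
    by (rule prod_mono) auto
  also have "\<dots> = card {xs. length xs = Suc q \<and> distinct xs \<and> set xs \<subseteq> D}"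
    using card_lists_distinct_length_eq[OF assms(1) True] by simp
  finally have "real ((card D - q) ^ Suc q)
      \<le> real (card {xs. length xs = Suc q \<and> distinct xs \<and> set xs \<subseteq> D})"
    by (simp only: of_nat_le_iff)
  moreover have "real ((card D - q) ^ Suc q) = (real (card D) - real q) ^ Suc q"
    using True by (simp add: of_nat_diff)
  moreover have "real (card D) - real q \<ge> 0"
    using True by simp
  ultimately show ?thesis
    using power_Suc_ge_tangent[of "real (card D) - real q" Y q] assms(2) by linarith
next
  case False
  \<comment> \<open>Now \<open>card D \<le> q\<close>, so the tangent is evaluated at a point that
    is at most 0, where its value is at most 0.\<close>
  have "real (Suc q) * Y ^ q * (real (card D) - real q - Y) \<le> real (Suc q) * Y ^ q * (- Y)"
    using False assms(2) by (intro mult_left_mono) auto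
  also have "\<dots> \<le> - (Y ^ Suc q)"
    using assms(2) by (simp add: algebra_simps)
  finally show ?thesis
    by linarith
qed

section \<open>Sliding windows and close pairs\<close>

text \<open>There are at most \<open>(b - a) / \<delta> + L\<close> windows and their counts add up
  to \<open>L * card S\<close>. The squared counts are bounded below by the tangent of the square at
  \<open>Z\<close>, a free parameter best thought of as the mean window count.\<close>

lemma sum_close_pairs_ge:
  fixes y :: "'a \<Rightarrow> real" and a b \<delta> Z :: real and L :: nat
  assumes "finite S" "\<And>i. i \<in> S \<Longrightarrow> a \<le> y i \<and> y i \<le> b" "a \<le> b" "\<delta> > 0"
  shows "2 * Z * real L * real (card S) - Z\<^sup>2 * ((b - a) / \<delta> + real L)
    \<le> (\<Sum>l=1..L. \<Sum>i\<in>S. real (card {j \<in> S. \<bar>y i - y j\<bar> \<le> real l * \<delta>}))"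
proof -
  define c where "c i = \<lfloor>(y i - a) / \<delta>\<rfloor>" for i
  define K where "K = \<lfloor>(b - a) / \<delta>\<rfloor>"
  \<comment> \<open>A window is named by its first cell. Starting at \<open>1 - L\<close> admits
    windows that overhang the left end, so that each cell from 0 to \<open>K\<close> lies in exactly
    \<open>L\<close> of them.\<close>
  define V where "V = {1 - int L..K}"
  define I where "I w i = (of_bool (w \<le> c i \<and> c i < w + int L) :: real)" for w i
  define W where "W w = (\<Sum>i\<in>S. I w i)" for w
  have K0: "K \<ge> 0"
    using assms by (simp add: K_def)
  have c_bounds: "0 \<le> c i \<and> c i \<le> K" if "i \<in> S" for i
    using assms(2)[OF that] assms(4)
    by (auto simp: c_def K_def intro!: floor_mono divide_right_mono)
  have "finite V"
    by (simp add: V_def)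
  have cardV: "real (card V) \<le> (b - a) / \<delta> + real L"
  proof -
    have "real (card V) = of_int K + real L"
      using K0 by (simp add: V_def)
    then show ?thesis
      by (simp add: K_def)
  qed
  have sum_W: "(\<Sum>w\<in>V. W w) = real L * real (card S)"
  proof -
    have "(\<Sum>w\<in>V. W w) = (\<Sum>i\<in>S. \<Sum>w\<in>V. I w i)"
      unfolding W_def by (rule sum.swap)
    also have "\<dots> = (\<Sum>i\<in>S. real L)"
    proof (rule sum.cong)
      fix i assume "i \<in> S"
      have "(\<Sum>w\<in>V. I w i) = real (card {w \<in> V. w \<le> c i \<and> c i < w + int L})"
        using \<open>finite V\<close> by (simp add: I_def sum_of_bool_eq Int_def)
      also have "{w \<in> V. w \<le> c i \<and> c i < w + int L} = {c i - int L + 1..c i}"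
        using c_bounds[OF \<open>i \<in> S\<close>] by (auto simp: V_def)
      finally show "(\<Sum>w\<in>V. I w i) = real L"
        by simp
    qed simp
    finally show ?thesis by simp
  qed
  have pair: "(\<Sum>w\<in>V. I w i * I w j) \<le> (\<Sum>l=1..L. of_bool (\<bar>y i - y j\<bar> \<le> real l * \<delta>))"
    if "i \<in> S" "j \<in> S" for i j
  proof -
    define A where "A = {w \<in> V. w \<le> c i \<and> c i < w + int L \<and> w \<le> c j \<and> c j < w + int L}"
    \<comment> \<open>\<open>f w\<close> is the position, counted from 1, of the later of the two
      cells in the window \<open>w\<close>. It determines \<open>w\<close>, and both cells lie among
      the first \<open>f w\<close> cells of the window, so the points are within
      \<open>f w * \<delta>\<close>. Thus each common window is charged to its own admissible
      \<open>l\<close>.\<close>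
    define f where "f w = nat (max (c i) (c j) - w + 1)" for w
    have "\<bar>y i - y j\<bar> \<le> real (f w) * \<delta>" if "w \<in> A" for w
    proof -
      have *: "of_int (c t) \<le> (y t - a) / \<delta>" "(y t - a) / \<delta> < of_int (c t) + 1" for t
        by (simp_all add: c_def)
      have "\<bar>(y i - a) / \<delta> - (y j - a) / \<delta>\<bar> \<le> of_int \<bar>c i - c j\<bar> + 1"
        using *[of i] *[of j] by linarith
      also have "\<dots> \<le> real (f w)"
      proof -
        have "\<bar>c i - c j\<bar> + 1 \<le> int (f w)"
          using that unfolding f_def A_def by auto
        then show ?thesis
          by linarith
      qed
      finally have "\<bar>(y i - y j) / \<delta>\<bar> \<le> real (f w)"
        by (simp add: diff_divide_distrib)
      then show ?thesis
        using assms(4) by (simp add: abs_divide pos_divide_le_eq)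
    qed
    moreover have "f w \<in> {1..L}" if "w \<in> A" for w
      using that unfolding f_def A_def by auto
    moreover have "inj_on f A"
      unfolding f_def A_def inj_on_def by auto
    ultimately have "card A \<le> card {l \<in> {1..L}. \<bar>y i - y j\<bar> \<le> real l * \<delta>}"
      by (intro card_inj_on_le[of f]) auto
    moreover have "(\<Sum>w\<in>V. I w i * I w j) = real (card A)"
      using \<open>finite V\<close>
      by (simp add: I_def A_def flip: of_bool_conj) (simp add: sum_of_bool_eq Int_def conj_ac)
    ultimately show ?thesis
      by (simp add: sum_of_bool_eq Int_def)
  qed
  have "2 * Z * real L * real (card S) - Z\<^sup>2 * ((b - a) / \<delta> + real L)
      \<le> 2 * Z * (real L * real (card S)) - Z\<^sup>2 * real (card V)"
    using mult_left_mono[OF cardV, of "Z\<^sup>2"] by simp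
  also have "\<dots> = (\<Sum>w\<in>V. 2 * Z * W w - Z\<^sup>2)"
    by (simp add: sum_subtractf flip: sum_W sum_distrib_left)
  also have "\<dots> \<le> (\<Sum>w\<in>V. (W w)\<^sup>2)"
  proof (rule sum_mono)
    fix w
    have "0 \<le> (W w - Z)\<^sup>2" by simp
    then show "2 * Z * W w - Z\<^sup>2 \<le> (W w)\<^sup>2"
      by (simp add: power2_eq_square algebra_simps)
  qed
  also have "\<dots> = (\<Sum>w\<in>V. \<Sum>i\<in>S. \<Sum>j\<in>S. I w i * I w j)"
    by (simp add: W_def power2_eq_square sum_product)
  also have "\<dots> = (\<Sum>i\<in>S. \<Sum>w\<in>V. \<Sum>j\<in>S. I w i * I w j)"
    by (rule sum.swap)
  also have "\<dots> = (\<Sum>i\<in>S. \<Sum>j\<in>S. \<Sum>w\<in>V. I w i * I w j)"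
    by (intro sum.cong refl sum.swap)
  also have "\<dots> \<le> (\<Sum>i\<in>S. \<Sum>j\<in>S. \<Sum>l=1..L. of_bool (\<bar>y i - y j\<bar> \<le> real l * \<delta>))"
    by (intro sum_mono pair)
  also have "\<dots> = (\<Sum>i\<in>S. \<Sum>l=1..L. \<Sum>j\<in>S. of_bool (\<bar>y i - y j\<bar> \<le> real l * \<delta>))"
    by (intro sum.cong refl sum.swap)
  also have "\<dots> = (\<Sum>l=1..L. \<Sum>i\<in>S. \<Sum>j\<in>S. of_bool (\<bar>y i - y j\<bar> \<le> real l * \<delta>))"
    by (rule sum.swap)
  also have "\<dots> = (\<Sum>l=1..L. \<Sum>i\<in>S. real (card {j \<in> S. \<bar>y i - y j\<bar> \<le> real l * \<delta>}))"
    using assms(1) by (simp add: sum_of_bool_eq Int_def)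
  finally show ?thesis .
qed

section \<open>From close pairs to lower bounds for correlations\<close>

lemma dist_nearest_int_le: "dist_nearest_int t \<le> \<bar>t\<bar>"
  using infdist_le[of 0 "\<int> :: real set" t] by (simp add: dist_nearest_int_def)

lemma finite_correlation_tuples:
  "finite {is :: nat list. length is = k \<and> set is \<subseteq> {1..N} \<and> distinct is \<and> P is}"
  by (rule finite_subset[OF _ finite_lists_length_eq[of "{1..N}" k]]) auto

lemma correlation_mono:
  assumes "s \<le> s'"
  shows "correlation k x s N \<le> correlation k x s' N"
proof -
  have "s / real N \<le> s' / real N"
    using assms by (simp add: divide_right_mono)
  then show ?thesis
    unfolding correlation_def
    by (intro divide_right_mono of_nat_mono card_mono finite_correlation_tuples) (auto intro: order_trans)
qed

text \<open>Tuples are counted by their first index, the rest being a list of distinct neighbours of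
  it. Ordinary distance suffices for a lower bound, since the distance to the nearest integer is
  never larger.\<close>

lemma correlation_ge_sum_lists:
  assumes "N \<ge> 1" "U \<subseteq> {1..N}"
    and D: "\<And>i. i \<in> U \<Longrightarrow> D i \<subseteq> {1..N} - {i}"
    and close: "\<And>i j. i \<in> U \<Longrightarrow> j \<in> D i \<Longrightarrow> \<bar>x i - x j\<bar> \<le> s / real N"
  shows "(\<Sum>i\<in>U. real (card {js. length js = p \<and> distinct js \<and> set js \<subseteq> D i}))
    \<le> real N * correlation (Suc p) x s N"
proof -
  define T where "T i = {js. length js = p \<and> distinct js \<and> set js \<subseteq> D i}" for i
  have "finite U"
    using assms(2) finite_subset by blast
  have finT: "finite (T i)" if "i \<in> U" for i
  proof -
    have "finite (D i)"
      using D[OF that] finite_subset by blast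
    from finite_lists_length_eq[OF this, of p] show ?thesis
      by (rule finite_subset[rotated]) (auto simp: T_def)
  qed
  have "(\<Sum>i\<in>U. card (T i)) = card (SIGMA i:U. T i)"
    using \<open>finite U\<close> finT by (simp add: card_SigmaI)
  also have "\<dots> \<le> card {is :: nat list. length is = Suc p \<and> set is \<subseteq> {1..N} \<and> distinct is \<and>
       (\<forall>r. 1 \<le> r \<and> r < Suc p \<longrightarrow> dist_nearest_int (x (is ! 0) - x (is ! r)) \<le> s / real N)}"
  proof (rule card_inj_on_le[of "\<lambda>(i, js). i # js"])
    show "(\<lambda>(i, js). i # js) ` (SIGMA i:U. T i) \<subseteq> {is. length is = Suc p \<and> set is \<subseteq> {1..N} \<and>
       distinct is \<and>
       (\<forall>r. 1 \<le> r \<and> r < Suc p \<longrightarrow> dist_nearest_int (x (is ! 0) - x (is ! r)) \<le> s / real N)}"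
    proof clarify
      fix i js
      assume i: "i \<in> U" and "js \<in> T i"
      then have js: "length js = p" "distinct js" "set js \<subseteq> D i"
        by (auto simp: T_def)
      have "dist_nearest_int (x i - x (js ! (r - 1))) \<le> s / real N" if "1 \<le> r" "r < Suc p" for r
      proof -
        have "js ! (r - 1) \<in> D i"
          using js that by (auto intro!: subsetD[OF js(3)] nth_mem)
        from close[OF i this] dist_nearest_int_le show ?thesis
          by (rule order_trans[rotated])
      qed
      then show "length (i # js) = Suc p \<and> set (i # js) \<subseteq> {1..N} \<and> distinct (i # js) \<and>
         (\<forall>r. 1 \<le> r \<and> r < Suc p \<longrightarrow>
           dist_nearest_int (x ((i # js) ! 0) - x ((i # js) ! r)) \<le> s / real N)"
        using js i D[OF i] assms(2) by (auto simp: nth_Cons')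
    qed
  next
    show "inj_on (\<lambda>(i, js). i # js) (SIGMA i:U. T i)"
      by (auto simp: inj_on_def)
  qed (rule finite_correlation_tuples)
  also have "real \<dots> = real N * correlation (Suc p) x s N"
    using assms(1) by (simp add: correlation_def)
  finally have "real (\<Sum>i\<in>U. card (T i)) \<le> real N * correlation (Suc p) x s N"
    by simp
  then show ?thesis
    by (simp add: T_def)
qed


text \<open>The tangent for the number of neighbours is taken at \<open>Y m * l\<close>. This makes
  \<open>l ^ q\<close> a common factor, and after division by it the neighbour counts carry a
  coefficient independent of \<open>l\<close>, as is needed to sum over \<open>l\<close> with the
  window bound.\<close>

lemma correlation_level_ge:
  fixes x :: "nat \<Rightarrow> real" and u v Y :: "nat \<Rightarrow> real"
  assumes "N \<ge> 1" "l \<ge> (1::nat)" "\<And>m. m < M \<Longrightarrow> Y m \<ge> 0"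
    and disj: "\<And>m m'. m < M \<Longrightarrow> m' < M \<Longrightarrow> m \<noteq> m' \<Longrightarrow> {u m<..v m} \<inter> {u m'<..v m'} = {}"
  defines "S m \<equiv> {n \<in> {1..N}. u m < x n \<and> x n \<le> v m}"
  shows "(\<Sum>m<M. \<Sum>i\<in>S m. Y m ^ Suc q * real l + real (Suc q) * Y m ^ q *
      (real (card {j \<in> S m. \<bar>x i - x j\<bar> \<le> real l * (s / real N)}) - real (Suc q) - Y m * real l))
    \<le> real N * (correlation (Suc (Suc q)) x (real l * s) N / real l ^ q)"
proof -
  define U where "U = (\<Union>m<M. S m)"
  define D where "D i = {j \<in> {1..N}. \<bar>x i - x j\<bar> \<le> real l * s / real N} - {i}" for i
  define T where "T i = real (card {js. length js = Suc q \<and> distinct js \<and> set js \<subseteq> D i})" for i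
  have "S m \<inter> S m' = {}" if "m < M" "m' < M" "m \<noteq> m'" for m m'
  proof -
    have "x n \<in> {u m<..v m} \<inter> {u m'<..v m'}" if "n \<in> S m \<inter> S m'" for n
      using that by (auto simp: S_def)
    then show ?thesis
      using disj[OF that] by blast
  qed
  then have "(\<Sum>m<M. sum T (S m)) = sum T U"
    unfolding U_def by (subst sum.UNION_disjoint) (auto simp: S_def)
  also have "\<dots> \<le> real N * correlation (Suc (Suc q)) x (real l * s) N"
    unfolding T_def by (rule correlation_ge_sum_lists) (use assms(1) in \<open>auto simp: U_def S_def D_def\<close>)
  finally have upper: "(\<Sum>m<M. sum T (S m)) \<le> real N * correlation (Suc (Suc q)) x (real l * s) N" .
  have "real l ^ q * (Y m ^ Suc q * real l + real (Suc q) * Y m ^ q *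
      (real (card {j \<in> S m. \<bar>x i - x j\<bar> \<le> real l * (s / real N)}) - real (Suc q) - Y m * real l))
      \<le> T i" (is "real l ^ q * (_ + _ * (real (card ?F) - _ - _)) \<le> _") if "m < M" "i \<in> S m" for m i
  proof -
    have "?F - {i} \<subseteq> D i"
      by (auto simp: D_def S_def)
    then have "card (?F - {i}) \<le> card (D i)"
      by (rule card_mono[rotated]) (simp add: D_def)
    \<comment> \<open>The point \<open>i\<close> belongs to \<open>?F\<close> but not to
      \<open>D i\<close>; this loss of 1 turns the \<open>q\<close> of the falling factorial into
      \<open>Suc q\<close>.\<close>
    then have *: "real (card ?F) \<le> real (card (D i)) + 1"
      by (simp add: card_Diff_singleton_if split: if_splits)
    have "real l ^ q * (Y m ^ Suc q * real l + real (Suc q) * Y m ^ q *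
          (real (card ?F) - real (Suc q) - Y m * real l))
        \<le> real l ^ q * (Y m ^ Suc q * real l + real (Suc q) * Y m ^ q *
          (real (card (D i)) - real q - Y m * real l))"
      using * assms(3)[OF that(1)] by (intro mult_left_mono add_left_mono) auto
    also have "\<dots> = (Y m * real l) ^ Suc q + real (Suc q) * (Y m * real l) ^ q *
          (real (card (D i)) - real q - Y m * real l)"
      by (simp add: power_mult_distrib algebra_simps)
    also have "\<dots> \<le> T i"
      unfolding T_def using assms(3)[OF that(1)] by (intro card_distinct_lists_ge) (auto simp: D_def)
    finally show ?thesis .
  qed
  then have "real l ^ q * (\<Sum>m<M. \<Sum>i\<in>S m. Y m ^ Suc q * real l + real (Suc q) * Y m ^ q *
      (real (card {j \<in> S m. \<bar>x i - x j\<bar> \<le> real l * (s / real N)}) - real (Suc q) - Y m * real l))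
      \<le> (\<Sum>m<M. sum T (S m))"
    unfolding sum_distrib_left by (intro sum_mono) auto
  also note upper
  finally show ?thesis
    using assms(2) by (simp add: pos_le_divide_eq mult.commute)
qed

text \<open>
  The tangents are free parameters: \<open>Z m\<close> is the point of tangency for the window counts in the
  interval \<open>{u m<..v m}\<close>, and \<open>Y m * l\<close> the one for the number of neighbours within \<open>l * s / N\<close>.
\<close>

lemma sum_correlation_ge:
  fixes x :: "nat \<Rightarrow> real" and u v Y Z :: "nat \<Rightarrow> real" and L :: nat
  assumes "N \<ge> 1" "s > 0" "\<And>m. m < M \<Longrightarrow> Y m \<ge> 0" "\<And>m. m < M \<Longrightarrow> u m \<le> v m"
    and disj: "\<And>m m'. m < M \<Longrightarrow> m' < M \<Longrightarrow> m \<noteq> m' \<Longrightarrow> {u m<..v m} \<inter> {u m'<..v m'} = {}"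
  defines "c m \<equiv> real (card {n \<in> {1..N}. u m < x n \<and> x n \<le> v m})"
    and "\<Lambda> \<equiv> \<Sum>l=1..L. real l"
  shows "(\<Sum>m<M. c m * (Y m ^ Suc q * \<Lambda> + real (Suc q) * Y m ^ q *
        (2 * Z m * real L - real L * real (Suc q) - Y m * \<Lambda>)) -
      real (Suc q) * Y m ^ q * (Z m)\<^sup>2 * ((v m - u m) * real N / s + real L))
    \<le> real N * (\<Sum>l=1..L. correlation (Suc (Suc q)) x (real l * s) N / real l ^ q)"
proof -
  define S where "S m = {n \<in> {1..N}. u m < x n \<and> x n \<le> v m}" for m
  define F where "F m l i = real (card {j \<in> S m. \<bar>x i - x j\<bar> \<le> real l * (s / real N)})" for m l i
  have c: "c m = real (card (S m))" for m
    by (simp add: c_def S_def)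
  have per_interval: "c m * (Y m ^ Suc q * \<Lambda> + real (Suc q) * Y m ^ q *
        (2 * Z m * real L - real L * real (Suc q) - Y m * \<Lambda>)) -
      real (Suc q) * Y m ^ q * (Z m)\<^sup>2 * ((v m - u m) * real N / s + real L)
    \<le> (\<Sum>l=1..L. \<Sum>i\<in>S m. Y m ^ Suc q * real l + real (Suc q) * Y m ^ q *
        (F m l i - real (Suc q) - Y m * real l))" if "m < M" for m
  proof -
    have "2 * Z m * real L * c m - (Z m)\<^sup>2 * ((v m - u m) / (s / real N) + real L)
        \<le> (\<Sum>l=1..L. \<Sum>i\<in>S m. F m l i)"
      unfolding c F_def
      by (rule sum_close_pairs_ge) (use assms(1,2,4) that in \<open>auto simp: S_def\<close>)
    then have "real (Suc q) * Y m ^ q *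
          (2 * Z m * real L * c m - (Z m)\<^sup>2 * ((v m - u m) * real N / s + real L))
        \<le> real (Suc q) * Y m ^ q * (\<Sum>l=1..L. \<Sum>i\<in>S m. F m l i)"
      using assms(3)[OF that] by (intro mult_left_mono) auto
    moreover have "(\<Sum>l=1..L. \<Sum>i\<in>S m. Y m ^ Suc q * real l + real (Suc q) * Y m ^ q *
          (F m l i - real (Suc q) - Y m * real l)) =
        c m * (Y m ^ Suc q * \<Lambda>) + real (Suc q) * Y m ^ q *
          ((\<Sum>l=1..L. \<Sum>i\<in>S m. F m l i) - real L * c m * real (Suc q) - c m * Y m * \<Lambda>)"
    proof -
      have "(\<Sum>l=1..L. \<Sum>i\<in>S m. A * real l + B * (F m l i - C - D * real l)) =
          c m * (A * \<Lambda>) + B * ((\<Sum>l=1..L. \<Sum>i\<in>S m. F m l i) - real L * c m * C - c m * D * \<Lambda>)"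
        for A B C D
        by (simp add: \<Lambda>_def c sum.distrib sum_subtractf sum_distrib_left algebra_simps)
      then show ?thesis .
    qed
    moreover have "C * (P + B * (2 * z * L' - L' * p - y * \<Lambda>)) - B * z2 * E =
        B * (2 * z * L' * C - z2 * E) + C * P - B * (L' * C * p + C * y * \<Lambda>)"
      "C * P + B * (W - L' * C * p - C * y * \<Lambda>) = B * W + C * P - B * (L' * C * p + C * y * \<Lambda>)"
      for C P B z L' p y z2 E W
      by (simp_all add: algebra_simps)
    ultimately show ?thesis
      by (simp only:)
  qed
  have "(\<Sum>m<M. c m * (Y m ^ Suc q * \<Lambda> + real (Suc q) * Y m ^ q *
        (2 * Z m * real L - real L * real (Suc q) - Y m * \<Lambda>)) -
      real (Suc q) * Y m ^ q * (Z m)\<^sup>2 * ((v m - u m) * real N / s + real L))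
    \<le> (\<Sum>m<M. \<Sum>l=1..L. \<Sum>i\<in>S m. Y m ^ Suc q * real l + real (Suc q) * Y m ^ q *
        (F m l i - real (Suc q) - Y m * real l))"
    using per_interval by (intro sum_mono) auto
  also have "\<dots> = (\<Sum>l=1..L. \<Sum>m<M. \<Sum>i\<in>S m. Y m ^ Suc q * real l + real (Suc q) * Y m ^ q *
        (F m l i - real (Suc q) - Y m * real l))"
    by (rule sum.swap)
  also have "\<dots> \<le> (\<Sum>l=1..L. real N * (correlation (Suc (Suc q)) x (real l * s) N / real l ^ q))"
    unfolding F_def S_def
    by (intro sum_mono correlation_level_ge) (use assms(1,3) disj in auto)
  also have "\<dots> = real N * (\<Sum>l=1..L. correlation (Suc (Suc q)) x (real l * s) N / real l ^ q)"
    by (simp add: sum_distrib_left)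
  finally show ?thesis .
qed

section \<open>Passage to the limit along \<open>N\<close>\<close>

lemma distribution_function_along_diff:
  assumes "distribution_function_along x N G" "0 \<le> u" "u \<le> v" "v \<le> 1"
  shows "(\<lambda>j. real (card {n \<in> {1..N j}. u < x n \<and> x n \<le> v}) / real (N j)) \<longlonglongrightarrow> G v - G u"
proof -
  define A where "A t j = {n \<in> {1..N j}. 0 \<le> x n \<and> x n \<le> t}" for t j
  have "card {n \<in> {1..N j}. u < x n \<and> x n \<le> v} = card (A v j) - card (A u j)"
    and le: "card (A u j) \<le> card (A v j)" for j
  proof -
    have "A u j \<subseteq> A v j" "finite (A v j)" "finite (A u j)"
      using assms by (auto simp: A_def)
    moreover have "{n \<in> {1..N j}. u < x n \<and> x n \<le> v} = A v j - A u j"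
      using assms by (auto simp: A_def)
    ultimately show "card {n \<in> {1..N j}. u < x n \<and> x n \<le> v} = card (A v j) - card (A u j)"
      "card (A u j) \<le> card (A v j)"
      by (simp_all add: card_Diff_subset card_mono)
  qed
  then have "(\<lambda>j. real (card {n \<in> {1..N j}. u < x n \<and> x n \<le> v}) / real (N j)) =
      (\<lambda>j. real (card (A v j)) / real (N j) - real (card (A u j)) / real (N j))"
    by (simp add: of_nat_diff diff_divide_distrib)
  moreover have "(\<lambda>j. real (card (A t j)) / real (N j)) \<longlonglongrightarrow> G t" if "t \<in> {0..1}" for t
    using assms(1) that by (auto simp: distribution_function_along_def A_def)
  ultimately show ?thesis
    using assms by (auto intro!: tendsto_diff)
qed

lemma distribution_function_along_eventually_ge:
  assumes "distribution_function_along x N G"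
  shows "eventually (\<lambda>j. N j \<ge> 1) sequentially"
proof -
  have "j \<le> N j" for j
    using assms by (auto simp: distribution_function_along_def intro: strict_mono_imp_increasing)
  then show ?thesis
    by (intro eventually_sequentiallyI[of 1]) (rule order_trans)
qed

lemma distribution_function_along_mono:
  assumes "distribution_function_along x N G" "0 \<le> u" "u \<le> v" "v \<le> 1"
  shows "G u \<le> G v"
  using LIMSEQ_le_const[OF distribution_function_along_diff[OF assms], of 0] by auto

text \<open>After division by \<open>N j\<close> the relative counts tend to increments of
  \<open>G\<close> and the boundary term \<open>L / N j\<close> vanishes. The lower bound for the
  correlation sums therefore converges, so an upper bound \<open>B\<close> holding for infinitely
  many \<open>j\<close> already bounds its limit. The negation of divergence in (i) supplies just
  such a bound.\<close>

lemma frequently_sum_correlation_le: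
  fixes x :: "nat \<Rightarrow> real" and u v Y Z :: "nat \<Rightarrow> real" and L :: nat
  assumes G: "distribution_function_along x N G" and "s > 0"
    and Y: "\<And>m. m < M \<Longrightarrow> Y m \<ge> 0"
    and uv: "\<And>m. m < M \<Longrightarrow> 0 \<le> u m \<and> u m \<le> v m \<and> v m \<le> 1"
    and disj: "\<And>m m'. m < M \<Longrightarrow> m' < M \<Longrightarrow> m \<noteq> m' \<Longrightarrow> {u m<..v m} \<inter> {u m'<..v m'} = {}"
    and freq: "frequently (\<lambda>j. (\<Sum>l=1..L. correlation (Suc (Suc q)) x (real l * s) (N j) / real l ^ q) \<le> B)
      sequentially"
  defines "\<Lambda> \<equiv> \<Sum>l=1..L. real l"
  shows "(\<Sum>m<M. (G (v m) - G (u m)) * (Y m ^ Suc q * \<Lambda> + real (Suc q) * Y m ^ q *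
        (2 * Z m * real L - real L * real (Suc q) - Y m * \<Lambda>)) -
      real (Suc q) * Y m ^ q * (Z m)\<^sup>2 * ((v m - u m) / s)) \<le> B"
    (is "?lhs \<le> B")
proof (rule ccontr)
  define K where "K m = Y m ^ Suc q * \<Lambda> + real (Suc q) * Y m ^ q *
        (2 * Z m * real L - real L * real (Suc q) - Y m * \<Lambda>)" for m
  define c where "c m j = real (card {n \<in> {1..N j}. u m < x n \<and> x n \<le> v m})" for m j
  \<comment> \<open>This is the left-hand side of \<open>sum_correlation_ge\<close> divided by
    \<open>N j\<close>.\<close>
  define f where "f j = (\<Sum>m<M. c m j / real (N j) * K m -
      real (Suc q) * Y m ^ q * (Z m)\<^sup>2 * ((v m - u m) / s + real L / real (N j)))" for j
  have "filterlim (\<lambda>j. real (N j)) at_top sequentially"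
    using G filterlim_subseq[of N]
    by (auto simp: distribution_function_along_def intro: filterlim_compose[OF filterlim_real_sequentially])
  then have L0: "(\<lambda>j. real L / real (N j)) \<longlonglongrightarrow> 0"
    by (intro tendsto_divide_0[OF tendsto_const] filterlim_at_top_imp_at_infinity)
  have "f \<longlonglongrightarrow> (\<Sum>m<M. (G (v m) - G (u m)) * K m -
      real (Suc q) * Y m ^ q * (Z m)\<^sup>2 * ((v m - u m) / s + 0))"
    unfolding f_def
  proof (intro tendsto_sum tendsto_diff tendsto_mult tendsto_add tendsto_const L0)
    fix m assume "m \<in> {..<M}"
    then show "(\<lambda>j. c m j / real (N j)) \<longlonglongrightarrow> G (v m) - G (u m)"
      unfolding c_def using uv by (intro distribution_function_along_diff[OF G]) auto
  qed
  then have lim: "f \<longlonglongrightarrow> ?lhs"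
    by (simp add: K_def)
  assume "\<not> ?lhs \<le> B"
  then have "eventually (\<lambda>j. f j > B) sequentially"
    using order_tendstoD(1)[OF lim] by simp
  with distribution_function_along_eventually_ge[OF G]
  have "eventually (\<lambda>j. \<not> (\<Sum>l=1..L. correlation (Suc (Suc q)) x (real l * s) (N j) / real l ^ q) \<le> B)
      sequentially"
  proof eventually_elim
    case (elim j)
    have "(\<Sum>m<M. c m j * K m -
        real (Suc q) * Y m ^ q * (Z m)\<^sup>2 * ((v m - u m) * real (N j) / s + real L)) =
        real (N j) * f j"
    proof -
      have "c * K - A * (h * n / s + L') = n * (c / n * K - A * (h / s + L' / n))"
        if "n > 0" for c K A h n L' :: real
        using that \<open>s > 0\<close> by (simp add: field_simps)
      then show ?thesis
        unfolding f_def sum_distrib_left using elim by (intro sum.cong) auto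
    qed
    moreover have "(\<Sum>m<M. c m j * K m -
        real (Suc q) * Y m ^ q * (Z m)\<^sup>2 * ((v m - u m) * real (N j) / s + real L))
        \<le> real (N j) * (\<Sum>l=1..L. correlation (Suc (Suc q)) x (real l * s) (N j) / real l ^ q)"
      unfolding c_def K_def \<Lambda>_def
      by (rule sum_correlation_ge) (use elim \<open>s > 0\<close> Y uv disj in auto)
    ultimately have "f j \<le> (\<Sum>l=1..L. correlation (Suc (Suc q)) x (real l * s) (N j) / real l ^ q)"
      using elim by simp
    then show ?case
      using elim by simp
  qed
  then show False
    using freq by (simp add: frequently_def)
qed


section \<open>Part (i): bounded correlations force absolute continuity\<close>

text \<open>Absolute continuity speaks of open intervals, the counting bounds of half-open ones. If
  the latter share \<open>t\<close>, the midpoint of \<open>max a c\<close> and \<open>t\<close>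
  lies in both open intervals.\<close>

lemma disjoint_half_open_intervals:
  fixes a b c d :: real
  assumes "a \<le> b" "c \<le> d" "{a<..<b} \<inter> {c<..<d} = {}"
  shows "{a<..b} \<inter> {c<..d} = {}"
proof (rule ccontr)
  assume "{a<..b} \<inter> {c<..d} \<noteq> {}"
  then obtain t where "t \<in> {a<..b}" "t \<in> {c<..d}"
    by blast
  then have "(max a c + t) / 2 \<in> {a<..<b} \<inter> {c<..<d}"
    by (auto simp: max_def field_simps)
  with assms(3) show False
    by blast
qed

lemma abs_continuous_if_frequently_bounded:
  assumes G: "distribution_function_along x N G" and "s > 0"
    and freq: "frequently (\<lambda>j. correlation (Suc (Suc q)) x s (N j) \<le> B) sequentially"
  shows "abs_continuous_on_interval 0 1 G"
  unfolding abs_continuous_on_interval_def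
proof (intro allI impI)
  fix \<epsilon> :: real assume "\<epsilon> > 0"
  \<comment> \<open>The slope is chosen so that \<open>B / Y < \<epsilon> / 2\<close>; then
    \<open>Z\<close> is such that \<open>2 * Z - Suc q - Y = Z\<close>, which makes the coefficient
    of each increment at least \<open>Y\<close>. \<open>K\<close> is the resulting cost per unit of
    length, and \<open>\<delta>\<close> keeps the total cost at most
    \<open>\<epsilon> / 2\<close>.\<close>
  define Y where "Y = max 1 (2 * B / \<epsilon> + 1)"
  define Z where "Z = Y + real (Suc q)"
  define K where "K = real (Suc q) * Y ^ q * Z\<^sup>2 / s"
  define \<delta> where "\<delta> = \<epsilon> / 2 / (K + 1)"
  have "Y \<ge> 1" "Y > 2 * B / \<epsilon>"
    by (auto simp: Y_def)
  have "K \<ge> 0"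
    using \<open>Y \<ge> 1\<close> \<open>s > 0\<close> by (simp add: K_def)
  have "B < Y * (\<epsilon> / 2)"
    using \<open>Y > 2 * B / \<epsilon>\<close> \<open>\<epsilon> > 0\<close> by (simp add: field_simps)
  show "\<exists>\<delta>>0. \<forall>(m::nat) u v. (\<forall>i<m. 0 \<le> u i \<and> u i \<le> v i \<and> v i \<le> 1) \<and>
      (\<forall>i<m. \<forall>j<m. i \<noteq> j \<longrightarrow> {u i<..<v i} \<inter> {u j<..<v j} = {}) \<and>
      (\<Sum>i<m. v i - u i) < \<delta> \<longrightarrow> (\<Sum>i<m. \<bar>G (v i) - G (u i)\<bar>) < \<epsilon>"
  proof (intro exI[of _ \<delta>] conjI allI impI; (elim conjE)?)
    show "\<delta> > 0"
      using \<open>\<epsilon> > 0\<close> \<open>K \<ge> 0\<close> by (simp add: \<delta>_def)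
  next
    fix m :: nat and u v :: "nat \<Rightarrow> real"
    assume uv: "\<forall>i<m. 0 \<le> u i \<and> u i \<le> v i \<and> v i \<le> 1"
      and disj: "\<forall>i<m. \<forall>j<m. i \<noteq> j \<longrightarrow> {u i<..<v i} \<inter> {u j<..<v j} = {}"
      and small: "(\<Sum>i<m. v i - u i) < \<delta>"
    define D where "D = (\<Sum>i<m. G (v i) - G (u i))"
    have mono: "G (u i) \<le> G (v i)" if "i < m" for i
      using distribution_function_along_mono[OF G] uv that by auto
    have "0 \<le> D"
      using mono by (auto simp: D_def intro!: sum_nonneg)
    have bound: "(\<Sum>i<m. (G (v i) - G (u i)) * (Y ^ Suc q * (\<Sum>l=1..1. real l) + real (Suc q) * Y ^ q *
        (2 * Z * real 1 - real 1 * real (Suc q) - Y * (\<Sum>l=1..1. real l))) -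
      real (Suc q) * Y ^ q * Z\<^sup>2 * ((v i - u i) / s)) \<le> B"
    proof (rule frequently_sum_correlation_le[OF G \<open>s > 0\<close>])
      show "{u i<..v i} \<inter> {u j<..v j} = {}" if "i < m" "j < m" "i \<noteq> j" for i j
        using disj uv that by (intro disjoint_half_open_intervals) auto
    qed (use uv freq \<open>Y \<ge> 1\<close> in auto)
    have eq: "(G (v i) - G (u i)) * (Y ^ Suc q * (\<Sum>l=1..1. real l) + real (Suc q) * Y ^ q *
        (2 * Z * real 1 - real 1 * real (Suc q) - Y * (\<Sum>l=1..1. real l))) -
      real (Suc q) * Y ^ q * Z\<^sup>2 * ((v i - u i) / s) =
      (G (v i) - G (u i)) * (Y ^ Suc q + real (Suc q) * Y ^ q * Z) - K * (v i - u i)" for i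
      by (simp add: K_def Z_def)
    have "D * (Y ^ Suc q + real (Suc q) * Y ^ q * Z) - K * (\<Sum>i<m. v i - u i) \<le> B"
    proof -
      have "(\<Sum>i<m. d i * A - K * e i) = (\<Sum>i<m. d i) * A - K * (\<Sum>i<m. e i)"
        for d e :: "nat \<Rightarrow> real" and A
        by (simp add: sum_subtractf sum_distrib_right sum_distrib_left)
      note this[of "\<lambda>i. G (v i) - G (u i)" _ "\<lambda>i. v i - u i", symmetric]
      with bound show ?thesis
        by (simp only: D_def eq)
    qed
    moreover have "D * Y \<le> D * (Y ^ Suc q + real (Suc q) * Y ^ q * Z)"
    proof -
      have "Y ^ 1 \<le> Y ^ Suc q"
        using \<open>Y \<ge> 1\<close> by (intro power_increasing) auto
      moreover have "0 \<le> real (Suc q) * Y ^ q * Z"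
        using \<open>Y \<ge> 1\<close> by (simp add: Z_def)
      ultimately show ?thesis
        using \<open>0 \<le> D\<close> by (intro mult_left_mono) simp_all
    qed
    moreover have "K * (\<Sum>i<m. v i - u i) \<le> \<epsilon> / 2"
    proof -
      have "K * (\<Sum>i<m. v i - u i) \<le> K * \<delta>"
        using small \<open>K \<ge> 0\<close> by (intro mult_left_mono) auto
      also have "\<dots> \<le> (K + 1) * \<delta>"
        using \<open>\<epsilon> > 0\<close> \<open>K \<ge> 0\<close> by (intro mult_right_mono) (simp_all add: \<delta>_def)
      also have "\<dots> = \<epsilon> / 2"
        using \<open>K \<ge> 0\<close> by (simp add: \<delta>_def del: divide_divide_eq_left)
      finally show ?thesis .
    qed
    moreover have "\<epsilon> / 2 \<le> Y * (\<epsilon> / 2)"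
      using \<open>\<epsilon> > 0\<close> \<open>Y \<ge> 1\<close> by simp
    ultimately have "Y * D < Y * \<epsilon>"
      using \<open>B < Y * (\<epsilon> / 2)\<close> by (simp add: mult.commute[of D])
    then have "D < \<epsilon>"
      using \<open>Y \<ge> 1\<close> by simp
    moreover have "(\<Sum>i<m. \<bar>G (v i) - G (u i)\<bar>) = D"
      using mono by (auto simp: D_def intro!: sum.cong)
    ultimately show "(\<Sum>i<m. \<bar>G (v i) - G (u i)\<bar>) < \<epsilon>"
      by simp
  qed
qed

section \<open>Part (ii): power sums of difference quotients\<close>

text \<open>With \<open>s = 1\<close> the tangent points are the counts expected at density
  \<open>\<rho> m\<close>: \<open>2 * \<rho> m * l\<close> neighbours within \<open>l / N\<close>,
  on both sides, and \<open>L * \<rho> m\<close> points in a window of \<open>L\<close> cells. Both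
  sides then grow like \<open>L\<^sup>2\<close>, and comparing leading coefficients gives the
  claim.\<close>

lemma sum_power_difference_quotients_le:
  fixes c s0 :: real and u v :: "nat \<Rightarrow> real"
  assumes G: "distribution_function_along x N G" and "c \<ge> 0"
    and bound: "\<And>s. s \<ge> s0 \<Longrightarrow>
      eventually (\<lambda>j. correlation (Suc (Suc q)) x s (N j) \<le> c * (2 * s) ^ Suc q) sequentially"
    and uv: "\<And>m. m < M \<Longrightarrow> 0 \<le> u m \<and> u m < v m \<and> v m \<le> 1"
    and disj: "\<And>m m'. m < M \<Longrightarrow> m' < M \<Longrightarrow> m \<noteq> m' \<Longrightarrow> {u m<..v m} \<inter> {u m'<..v m'} = {}"
  shows "(\<Sum>m<M. (v m - u m) * ((G (v m) - G (u m)) / (v m - u m)) ^ Suc (Suc q)) \<le> c"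
    (is "?sum \<le> c")
proof -
  define l0 where "l0 = nat \<lceil>max s0 1\<rceil>"
  have "real l0 \<ge> s0"
    unfolding l0_def using real_nat_ceiling_ge[of "max s0 1"] by linarith
  \<comment> \<open>By monotonicity in \<open>s\<close>, the bound at \<open>l0\<close> also covers
    all \<open>l < l0\<close>. These scales contribute at most \<open>l0 * C\<close>, independently
    of \<open>L\<close>.\<close>
  define C where "C = c * (2 * real l0) ^ Suc q"
  have "C \<ge> 0"
    using \<open>c \<ge> 0\<close> by (simp add: C_def)
  define h where "h m = v m - u m" for m
  define \<rho> where "\<rho> m = (G (v m) - G (u m)) / h m" for m
  have h: "h m > 0" and \<rho>: "\<rho> m \<ge> 0" if "m < M" for m
    using uv[OF that] distribution_function_along_mono[OF G, of "u m" "v m"]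
    by (auto simp: h_def \<rho>_def)
  \<comment> \<open>\<open>E\<close> collects what is lost at first order in \<open>L\<close>: the
    shift by \<open>Suc q\<close> in the tuple count, and the excess of
    \<open>\<Lambda> = L * (L + 1) / 2\<close> over \<open>L\<^sup>2 / 2\<close>.\<close>
  define E where "E = (\<Sum>m<M. real (Suc q) * (2 * \<rho> m) ^ q * \<rho> m * h m * (real (Suc q) + \<rho> m))"
  have main: "2 ^ Suc q * (\<Sum>l=1..L. real l) * ?sum - real L * E
      \<le> c * 2 ^ Suc q * (\<Sum>l=1..L. real l) + real l0 * C" for L
  proof -
    define \<Lambda> where "\<Lambda> = (\<Sum>l=1..L. real l)"
    have \<Lambda>: "2 * \<Lambda> = real L * (real L + 1)"
      unfolding \<Lambda>_def by (induction L) (auto simp: algebra_simps)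
    have "eventually (\<lambda>j. \<forall>l\<in>{1..L}. correlation (Suc (Suc q)) x (real l * 1) (N j) / real l ^ q
        \<le> c * 2 ^ Suc q * real l + (if l < l0 then C else 0)) sequentially"
    proof (intro eventually_ball_finite ballI)
      fix l assume "l \<in> {1..L}"
      then have "real l ^ q \<ge> 1"
        by simp
      show "eventually (\<lambda>j. correlation (Suc (Suc q)) x (real l * 1) (N j) / real l ^ q
        \<le> c * 2 ^ Suc q * real l + (if l < l0 then C else 0)) sequentially"
      proof (cases "l < l0")
        case True
        show ?thesis
          using bound[OF \<open>real l0 \<ge> s0\<close>]
        proof eventually_elim
          case (elim j)
          have "correlation (Suc (Suc q)) x (real l) (N j) \<le> correlation (Suc (Suc q)) x (real l0) (N j)"
            using True by (intro correlation_mono) simp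
          also have "\<dots> \<le> C"
            using elim by (simp add: C_def)
          also have "C \<le> C * real l ^ q"
            using \<open>C \<ge> 0\<close> \<open>real l ^ q \<ge> 1\<close> mult_left_mono by fastforce
          finally have "correlation (Suc (Suc q)) x (real l) (N j) / real l ^ q \<le> C"
            using \<open>C \<ge> 0\<close> \<open>real l ^ q \<ge> 1\<close> by (simp add: divide_le_eq)
          then show ?case
            using True \<open>c \<ge> 0\<close> by (simp add: add_increasing)
        qed
      next
        case False
        then have "s0 \<le> real l"
          using \<open>real l0 \<ge> s0\<close> by linarith
        show ?thesis
          using bound[OF \<open>s0 \<le> real l\<close>]
        proof eventually_elim
          case (elim j)
          have "c * (2 * real l) ^ Suc q = c * 2 ^ Suc q * real l * real l ^ q"
            by (simp add: power_mult_distrib)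
          with elim have "correlation (Suc (Suc q)) x (real l) (N j) / real l ^ q \<le> c * 2 ^ Suc q * real l"
            using \<open>real l ^ q \<ge> 1\<close> by (simp only: pos_divide_le_eq)
          then show ?case
            using False by simp
        qed
      qed
    qed simp
    then have "eventually (\<lambda>j. (\<Sum>l=1..L. correlation (Suc (Suc q)) x (real l * 1) (N j) / real l ^ q)
        \<le> c * 2 ^ Suc q * \<Lambda> + real l0 * C) sequentially"
    proof eventually_elim
      case (elim j)
      have "(\<Sum>l=1..L. correlation (Suc (Suc q)) x (real l * 1) (N j) / real l ^ q)
          \<le> (\<Sum>l=1..L. c * 2 ^ Suc q * real l + (if l < l0 then C else 0))"
        using elim by (intro sum_mono) auto
      also have "\<dots> = c * 2 ^ Suc q * \<Lambda> + (\<Sum>l\<in>{l \<in> {1..L}. l < l0}. C)"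
        unfolding \<Lambda>_def sum.distrib sum_distrib_left by (subst sum.inter_filter) auto
      also have "(\<Sum>l\<in>{l \<in> {1..L}. l < l0}. C) \<le> (\<Sum>l<l0. C)"
        using \<open>C \<ge> 0\<close> by (intro sum_mono2) auto
      finally show ?case
        by simp
    qed
    then have "frequently (\<lambda>j. (\<Sum>l=1..L. correlation (Suc (Suc q)) x (real l * 1) (N j) / real l ^ q)
        \<le> c * 2 ^ Suc q * \<Lambda> + real l0 * C) sequentially"
      by (rule eventually_frequently[rotated]) simp
    note freq = this[unfolded \<Lambda>_def]
    have "(\<Sum>m<M. (G (v m) - G (u m)) * ((2 * \<rho> m) ^ Suc q * \<Lambda> + real (Suc q) * (2 * \<rho> m) ^ q *
        (2 * (real L * \<rho> m) * real L - real L * real (Suc q) - 2 * \<rho> m * \<Lambda>)) -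
      real (Suc q) * (2 * \<rho> m) ^ q * (real L * \<rho> m)\<^sup>2 * ((v m - u m) / 1))
      \<le> c * 2 ^ Suc q * \<Lambda> + real l0 * C"
      unfolding \<Lambda>_def
      by (rule frequently_sum_correlation_le[where Y = "\<lambda>m. 2 * \<rho> m" and Z = "\<lambda>m. real L * \<rho> m",
            OF G _ _ _ disj freq]) (use uv \<rho> in \<open>auto intro: less_imp_le\<close>)
    \<comment> \<open>Since \<open>2 * \<Lambda> = L * (L + 1)\<close>, the terms of order
      \<open>L\<^sup>2\<close> multiplying the slope cancel, and only the linear loss remains beside
      the main term.\<close>
    also have "(\<Sum>m<M. (G (v m) - G (u m)) * ((2 * \<rho> m) ^ Suc q * \<Lambda> + real (Suc q) * (2 * \<rho> m) ^ q *
        (2 * (real L * \<rho> m) * real L - real L * real (Suc q) - 2 * \<rho> m * \<Lambda>)) -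
      real (Suc q) * (2 * \<rho> m) ^ q * (real L * \<rho> m)\<^sup>2 * ((v m - u m) / 1)) =
      (\<Sum>m<M. 2 ^ Suc q * \<Lambda> * (h m * \<rho> m ^ Suc (Suc q)) -
        real L * (real (Suc q) * (2 * \<rho> m) ^ q * \<rho> m * h m * (real (Suc q) + \<rho> m)))"
    proof (intro sum.cong refl)
      fix m assume "m \<in> {..<M}"
      then have "G (v m) - G (u m) = \<rho> m * h m"
        using h[of m] by (simp add: \<rho>_def)
      moreover have "r * g * (P * \<Lambda> + A * (2 * (L' * r) * L' - L' * p - r * (L' * (L' + 1)))) -
          A * (L' * r)\<^sup>2 * (g / 1) = P * (g * r) * \<Lambda> - L' * (A * r * g * (p + r))" for r g P A L' p
        by (simp add: algebra_simps power2_eq_square)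
      moreover have "2 * \<rho> m * \<Lambda> = \<rho> m * (real L * (real L + 1))"
        using \<Lambda> by simp
      moreover have "v m - u m = h m"
        by (simp add: h_def)
      ultimately show "(G (v m) - G (u m)) * ((2 * \<rho> m) ^ Suc q * \<Lambda> + real (Suc q) * (2 * \<rho> m) ^ q *
          (2 * (real L * \<rho> m) * real L - real L * real (Suc q) - 2 * \<rho> m * \<Lambda>)) -
        real (Suc q) * (2 * \<rho> m) ^ q * (real L * \<rho> m)\<^sup>2 * ((v m - u m) / 1) =
        2 ^ Suc q * \<Lambda> * (h m * \<rho> m ^ Suc (Suc q)) -
          real L * (real (Suc q) * (2 * \<rho> m) ^ q * \<rho> m * h m * (real (Suc q) + \<rho> m))"
        by (simp only:) (simp add: power_mult_distrib)
    qed
    also have "\<dots> = 2 ^ Suc q * \<Lambda> * ?sum - real L * E"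
      by (simp only: sum_subtractf E_def sum_distrib_left h_def \<rho>_def)
    finally show ?thesis
      by (simp add: \<Lambda>_def)
  qed
  \<comment> \<open>Multiplied by \<open>2 / L\<^sup>2\<close>, the inequality \<open>main\<close>
    loses both \<open>E\<close> and \<open>C\<close> as \<open>L\<close> tends to infinity.\<close>
  have lim: "(\<lambda>L. 1 / real L) \<longlonglongrightarrow> 0"
    by (rule lim_1_over_n)
  have "(\<lambda>L. (2 ^ Suc q * (1 + 1 / real L) * ?sum - 2 * (1 / real L) * E) / 2 ^ Suc q) \<longlonglongrightarrow>
      (2 ^ Suc q * (1 + 0) * ?sum - 2 * 0 * E) / 2 ^ Suc q"
    by (intro tendsto_intros lim) simp
  moreover have "(\<lambda>L. (c * 2 ^ Suc q * (1 + 1 / real L) + real l0 * C * (2 * (1 / real L) * (1 / real L))) / 2 ^ Suc q)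
      \<longlonglongrightarrow> (c * 2 ^ Suc q * (1 + 0) + real l0 * C * (2 * 0 * 0)) / 2 ^ Suc q"
    by (intro tendsto_intros lim) simp
  ultimately have "(2 ^ Suc q * (1 + 0) * ?sum - 2 * 0 * E) / 2 ^ Suc q
      \<le> (c * 2 ^ Suc q * (1 + 0) + real l0 * C * (2 * 0 * 0)) / 2 ^ Suc q"
  proof (rule LIMSEQ_le, intro exI[of _ 1] allI impI divide_right_mono)
    fix L :: nat assume "L \<ge> 1"
    have \<Lambda>: "(\<Sum>l=1..L. real l) = real L * (real L + 1) / 2"
      by (induction L) (auto simp: field_simps)
    have "(2 ^ Suc q * (real L * (real L + 1) / 2) * ?sum - real L * E) * (2 / (real L)\<^sup>2)
        \<le> (c * 2 ^ Suc q * (real L * (real L + 1) / 2) + real l0 * C) * (2 / (real L)\<^sup>2)"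
      using main[of L] unfolding \<Lambda> by (intro mult_right_mono) auto
    moreover have "(A * (real L * (real L + 1) / 2) * S - real L * E) * (2 / (real L)\<^sup>2) =
        A * (1 + 1 / real L) * S - 2 * (1 / real L) * E"
      "(A * (real L * (real L + 1) / 2) + R) * (2 / (real L)\<^sup>2) =
        A * (1 + 1 / real L) + R * (2 * (1 / real L) * (1 / real L))" for A S R
      using \<open>L \<ge> 1\<close> by (simp_all add: field_simps power2_eq_square)
    ultimately show "2 ^ Suc q * (1 + 1 / real L) * ?sum - 2 * (1 / real L) * E
        \<le> c * 2 ^ Suc q * (1 + 1 / real L) + real l0 * C * (2 * (1 / real L) * (1 / real L))"
      by (simp only:)
  qed simp
  then show ?thesis
    by simp
qed


section \<open>From difference quotients to the density\<close>

text \<open>Neither endpoint is fixed at \<open>t\<close>, but \<open>t\<close> lies between them,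
  so the linearization errors, at most \<open>r / 2\<close> times the distances to \<open>t\<close>,
  add up to at most \<open>r / 2 * (b n - a n)\<close>.\<close>

lemma difference_quotient_straddle:
  fixes f :: "real \<Rightarrow> real"
  assumes f: "(f has_real_derivative f') (at t within S)"
    and ab: "\<And>n. a n \<in> S \<and> b n \<in> S \<and> a n < t \<and> t \<le> b n"
    and lim: "(\<lambda>n. b n - a n) \<longlonglongrightarrow> 0"
  shows "(\<lambda>n. (f (b n) - f (a n)) / (b n - a n)) \<longlonglongrightarrow> f'"
proof (rule LIMSEQ_I)
  fix r :: real assume "r > 0"
  then obtain d where "d > 0" and d: "\<And>y. y \<in> S \<Longrightarrow> \<bar>y - t\<bar> < d \<Longrightarrow>
      \<bar>f y - f t - f' * (y - t)\<bar> \<le> r / 2 * \<bar>y - t\<bar>"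
    using f unfolding has_field_derivative_def has_derivative_within_alt
    by (auto dest!: spec[of _ "r / 2"])
  from LIMSEQ_D[OF lim \<open>d > 0\<close>] obtain n0 where n0: "\<And>n. n \<ge> n0 \<Longrightarrow> \<bar>b n - a n\<bar> < d"
    by auto
  have "norm ((f (b n) - f (a n)) / (b n - a n) - f') < r" if "n \<ge> n0" for n
  proof -
    have "\<bar>a n - t\<bar> < d" "\<bar>b n - t\<bar> < d"
      using n0[OF that] ab[of n] by auto
    then have "\<bar>f (a n) - f t - f' * (a n - t)\<bar> \<le> r / 2 * (t - a n)"
      "\<bar>f (b n) - f t - f' * (b n - t)\<bar> \<le> r / 2 * (b n - t)"
      using d[of "a n"] d[of "b n"] ab[of n] by auto
    have "\<bar>(f (b n) - f (a n)) - f' * (b n - a n)\<bar> \<le> r / 2 * (b n - a n)"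
    proof -
      have "(f (b n) - f (a n)) - f' * (b n - a n) =
          (f (b n) - f t - f' * (b n - t)) - (f (a n) - f t - f' * (a n - t))"
        "r / 2 * (b n - a n) = r / 2 * (b n - t) + r / 2 * (t - a n)"
        by (simp_all add: field_simps)
      then show ?thesis
        using \<open>\<bar>f (a n) - f t - _\<bar> \<le> _\<close> \<open>\<bar>f (b n) - f t - _\<bar> \<le> _\<close> by linarith
    qed
    also have "\<dots> < r * (b n - a n)"
      using ab[of n] \<open>r > 0\<close> by simp
    finally have "\<bar>(f (b n) - f (a n)) - f' * (b n - a n)\<bar> / (b n - a n) < r"
      using ab[of n] by (simp add: pos_divide_less_eq)
    moreover have "(f (b n) - f (a n)) / (b n - a n) - f' =
        ((f (b n) - f (a n)) - f' * (b n - a n)) / (b n - a n)"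
      using ab[of n] by (simp add: field_simps)
    moreover have "\<bar>b n - a n\<bar> = b n - a n"
      using ab[of n] by simp
    ultimately show ?thesis
      by (simp only: real_norm_def abs_divide)
  qed
  then show "\<exists>no. \<forall>n\<ge>no. norm ((f (b n) - f (a n)) / (b n - a n) - f') < r"
    by blast
qed

text \<open>The step functions \<open>h n\<close>, whose values are powers of difference quotients
  on a uniform partition, have integral at most \<open>c\<close> and converge almost everywhere to
  the power of \<open>g\<close>; Fatou's lemma concludes.\<close>

lemma nn_integral_deriv_power_le:
  fixes G g :: "real \<Rightarrow> real"
  assumes mono: "\<And>u v. 0 \<le> u \<Longrightarrow> u \<le> v \<Longrightarrow> v \<le> 1 \<Longrightarrow> G u \<le> G v"
    and deriv: "AE t in lebesgue_on {0..1}. (G has_real_derivative g t) (at t within {0..1})"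
    and le: "\<And>M u v. (\<And>m. m < M \<Longrightarrow> u m = real m / real M \<and> v m = real (Suc m) / real M) \<Longrightarrow>
      (\<Sum>m<M. (v m - u m) * ((G (v m) - G (u m)) / (v m - u m)) ^ p) \<le> c"
  shows "(\<integral>\<^sup>+ t. ennreal (g t ^ p) \<partial>lebesgue_on {0..1}) \<le> ennreal c"
proof -
  define u where "u n m = real m / real (Suc n)" for n m
  define v where "v n m = real (Suc m) / real (Suc n)" for n m
  define C where "C n m = ((G (v n m) - G (u n m)) / (v n m - u n m)) ^ p" for n m
  define h where "h n t = (\<Sum>m<Suc n. ennreal (C n m) * indicator {u n m<..v n m} t)" for n t
  have uv: "0 \<le> u n m" "u n m < v n m" "v n m \<le> 1" if "m < Suc n" for n m
    using that by (auto simp: u_def v_def field_simps)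
  have C0: "C n m \<ge> 0" if "m < Suc n" for n m
    using uv[OF that] mono[of "u n m" "v n m"] by (auto simp: C_def intro!: zero_le_power)
  have meas: "{u n m<..v n m} \<in> sets (lebesgue_on {0..1})" if "m < Suc n" for n m
    using uv[OF that] by (auto simp: sets_restrict_space image_iff intro!: exI[of _ "{u n m<..v n m}"])
  have h_le: "(\<integral>\<^sup>+ t. h n t \<partial>lebesgue_on {0..1}) \<le> ennreal c" for n
  proof -
    have "(\<integral>\<^sup>+ t. h n t \<partial>lebesgue_on {0..1}) =
        (\<Sum>m<Suc n. ennreal (C n m) * emeasure (lebesgue_on {0..1}) {u n m<..v n m})"
      unfolding h_def
    proof (subst nn_integral_sum)
      fix m assume "m \<in> {..<Suc n}"
      then show "(\<lambda>t. ennreal (C n m) * indicator {u n m<..v n m} t) \<in> borel_measurable (lebesgue_on {0..1})"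
        using meas by (intro borel_measurable_times_ennreal borel_measurable_indicator) auto
    next
      show "(\<Sum>m<Suc n. \<integral>\<^sup>+ t. ennreal (C n m) * indicator {u n m<..v n m} t \<partial>lebesgue_on {0..1}) =
          (\<Sum>m<Suc n. ennreal (C n m) * emeasure (lebesgue_on {0..1}) {u n m<..v n m})"
        by (intro sum.cong refl nn_integral_cmult_indicator meas) simp
    qed
    also have "\<dots> = (\<Sum>m<Suc n. ennreal ((v n m - u n m) * C n m))"
    proof (intro sum.cong refl)
      fix m assume "m \<in> {..<Suc n}"
      then have m: "m < Suc n" by simp
      have "emeasure (lebesgue_on {0..1}) {u n m<..v n m} = emeasure lebesgue {u n m<..v n m}"
        using uv[OF m] by (intro emeasure_restrict_space) auto
      also have "\<dots> = ennreal (v n m - u n m)"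
        using uv[OF m] by simp
      finally show "ennreal (C n m) * emeasure (lebesgue_on {0..1}) {u n m<..v n m} =
          ennreal ((v n m - u n m) * C n m)"
        using uv[OF m] C0[OF m] by (simp add: ennreal_mult mult.commute)
    qed
    also have "\<dots> = ennreal (\<Sum>m<Suc n. (v n m - u n m) * C n m)"
    proof (rule sum_ennreal)
      show "0 \<le> (v n m - u n m) * C n m" if "m \<in> {..<Suc n}" for m
        using that uv[of m n] C0[of m n] by simp
    qed
    also have "\<dots> \<le> ennreal c"
      unfolding C_def using le[of "Suc n" "u n" "v n"] by (intro ennreal_leI) (simp add: u_def v_def)
    finally show ?thesis .
  qed
  have lim: "(\<lambda>n. h n t) \<longlonglongrightarrow> ennreal (g t ^ p)"
    if t: "0 < t" "t \<le> 1" and "(G has_real_derivative g t) (at t within {0..1})" for t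
  proof -
    \<comment> \<open>This is the index of the cell containing \<open>t\<close>. The cells are
      closed on the right, hence the ceiling minus one, which is nonnegative because
      \<open>t > 0\<close>.\<close>
    define m where "m n = nat (\<lceil>t * real (Suc n)\<rceil> - 1)" for n
    have "0 < \<lceil>t * real (Suc n)\<rceil>" for n
      using t by (simp del: of_nat_Suc)
    then have m: "real (m n) = of_int \<lceil>t * real (Suc n)\<rceil> - 1" for n
      by (simp add: m_def)
    have tm: "real (m n) < t * real (Suc n)" "t * real (Suc n) \<le> real (Suc (m n))" for n
      using ceiling_correct[of "t * real (Suc n)"] m[of n] by auto
    then have tuv: "u n (m n) < t" "t \<le> v n (m n)" for n
      by (simp_all add: u_def v_def pos_divide_less_eq pos_le_divide_eq del: of_nat_Suc)
    have t_le: "t * real (Suc n) \<le> 1 * real (Suc n)" for n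
      using t by (intro mult_right_mono) auto
    have mn: "m n < Suc n" for n
      using less_le_trans[OF tm(1) t_le, of n] by (simp del: of_nat_Suc)
    have "h n t = ennreal (C n (m n))" for n
    proof -
      have "t \<notin> {u n i<..v n i}" if "i \<noteq> m n" for i
      proof
        assume "t \<in> {u n i<..v n i}"
        then have "real i < t * real (Suc n)" "t * real (Suc n) \<le> real (Suc i)"
          by (simp_all add: u_def v_def pos_divide_less_eq pos_le_divide_eq del: of_nat_Suc)
        then have "real i < real (Suc (m n))" "real (m n) < real (Suc i)"
          using tm[of n] by linarith+
        then show False
          using that by simp
      qed
      then have "h n t = (\<Sum>i<Suc n. if i = m n then ennreal (C n i) else 0)"
        unfolding h_def using tuv[of n] by (intro sum.cong) (auto simp: indicator_def)
      then show ?thesis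
        using mn[of n] by simp
    qed
    moreover have "(\<lambda>n. C n (m n)) \<longlonglongrightarrow> g t ^ p"
      unfolding C_def
    proof (intro tendsto_power difference_quotient_straddle[where t = t and S = "{0..1}"])
      show "(\<lambda>n. v n (m n) - u n (m n)) \<longlonglongrightarrow> 0"
        using LIMSEQ_inverse_real_of_nat by (simp add: u_def v_def field_simps)
      show "u n (m n) \<in> {0..1} \<and> v n (m n) \<in> {0..1} \<and> u n (m n) < t \<and> t \<le> v n (m n)" for n
        using uv[OF mn, of n] tuv[of n] by auto
    qed fact
    ultimately show ?thesis
      by (simp add: tendsto_ennrealI)
  qed
  \<comment> \<open>The point 0 lies in no half-open cell and is discarded as a null set.\<close>
  have "AE t in lebesgue. t \<noteq> (0::real)"
    by (rule AE_completion[OF AE_lborel_singleton])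
  then have "AE t in lebesgue_on {0..1}. t \<noteq> (0::real)"
    by (auto simp: AE_restrict_space_iff elim: eventually_mono)
  moreover have "AE t in lebesgue_on {0..1::real}. t \<in> {0..1}"
    by (rule AE_I2) simp
  ultimately have "AE t in lebesgue_on {0..1}. ennreal (g t ^ p) \<le> liminf (\<lambda>n. h n t)"
    using deriv
  proof eventually_elim
    case (elim t)
    then have "(\<lambda>n. h n t) \<longlonglongrightarrow> ennreal (g t ^ p)"
      by (intro lim) auto
    from lim_imp_Liminf[OF _ this] show ?case
      by simp
  qed
  then have "(\<integral>\<^sup>+ t. ennreal (g t ^ p) \<partial>lebesgue_on {0..1}) \<le>
      (\<integral>\<^sup>+ t. liminf (\<lambda>n. h n t) \<partial>lebesgue_on {0..1})"
    by (rule nn_integral_mono_AE)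
  also have "\<dots> \<le> liminf (\<lambda>n. \<integral>\<^sup>+ t. h n t \<partial>lebesgue_on {0..1})"
  proof (rule nn_integral_liminf)
    show "h n \<in> borel_measurable (lebesgue_on {0..1})" for n
      unfolding h_def using meas
      by (intro borel_measurable_sum borel_measurable_times_ennreal borel_measurable_indicator) auto
  qed
  also have "\<dots> \<le> limsup (\<lambda>n. \<integral>\<^sup>+ t. h n t \<partial>lebesgue_on {0..1})"
    by (rule Liminf_le_Limsup) simp
  also have "\<dots> \<le> ennreal c"
    using h_le by (intro Limsup_bounded) auto
  finally show ?thesis .
qed

section \<open>Conclusion of both parts\<close>

lemma Limsup_correlation_ge:
  fixes g :: "real \<Rightarrow> real"
  assumes G: "distribution_function_along x N G"
    and deriv: "AE t in lebesgue_on {0..1}. (G has_real_derivative g t) (at t within {0..1})"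
  shows "(\<integral>\<^sup>+ t. ennreal (g t ^ Suc (Suc q)) \<partial>lebesgue_on {0..1}) \<le>
    Limsup at_top (\<lambda>s. limsup (\<lambda>j. ennreal (correlation (Suc (Suc q)) x s (N j))) / ennreal ((2 * s) ^ Suc q))"
    (is "?I \<le> Limsup at_top (\<lambda>s. ?F s / _)")
proof (rule ccontr)
  assume "\<not> ?thesis"
  \<comment> \<open>A value strictly between the two sides is finite, even when the integral is
    infinite, and gives the real constant \<open>c\<close> for the partition bound.\<close>
  then obtain c' where "Limsup at_top (\<lambda>s. ?F s / ennreal ((2 * s) ^ Suc q)) < c'" "c' < ?I"
    unfolding not_le using dense by blast
  moreover obtain c where c: "c \<ge> 0" "c' = ennreal c"
    using \<open>c' < ?I\<close> by (cases c') auto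
  ultimately have less: "Limsup at_top (\<lambda>s. ?F s / ennreal ((2 * s) ^ Suc q)) < ennreal c"
    and "ennreal c < ?I"
    by auto
  from Limsup_lessD[OF less] obtain s1 where
    s1: "\<And>s. s \<ge> s1 \<Longrightarrow> ?F s / ennreal ((2 * s) ^ Suc q) < ennreal c"
    unfolding eventually_at_top_linorder by blast
  have bound: "eventually (\<lambda>j. correlation (Suc (Suc q)) x s (N j) \<le> c * (2 * s) ^ Suc q) sequentially"
    \<comment> \<open>The lower bound 1 makes the divisor positive, so the division in
      \<open>ennreal\<close> can be cleared.\<close>
    if "s \<ge> max s1 1" for s
  proof -
    have pos: "(2 * s) ^ Suc q > 0"
      using that by (intro zero_less_power) auto
    have "?F s < ennreal c * ennreal ((2 * s) ^ Suc q)"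
      using s1[of s] that pos divide_less_ennreal[of "ennreal ((2 * s) ^ Suc q)" "?F s" "ennreal c"]
      by simp
    also have "\<dots> = ennreal (c * (2 * s) ^ Suc q)"
      using c(1) pos by (intro ennreal_mult[symmetric]) auto
    finally have "eventually (\<lambda>j. ennreal (correlation (Suc (Suc q)) x s (N j)) <
        ennreal (c * (2 * s) ^ Suc q)) sequentially"
      by (rule Limsup_lessD)
    then show ?thesis
    proof eventually_elim
      case (elim j)
      have "0 \<le> correlation (Suc (Suc q)) x s (N j)"
        by (simp add: correlation_def)
      with elim show ?case
        by (simp add: ennreal_less_iff)
    qed
  qed
  have "?I \<le> ennreal c"
  proof (rule nn_integral_deriv_power_le[OF _ deriv])
    fix M :: nat and u v :: "nat \<Rightarrow> real"
    assume uv: "\<And>m. m < M \<Longrightarrow> u m = real m / real M \<and> v m = real (Suc m) / real M"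
    show "(\<Sum>m<M. (v m - u m) * ((G (v m) - G (u m)) / (v m - u m)) ^ Suc (Suc q)) \<le> c"
    proof (rule sum_power_difference_quotients_le[OF G c(1) bound])
      show "0 \<le> u m \<and> u m < v m \<and> v m \<le> 1" if "m < M" for m
        using that by (simp add: uv[OF that] divide_strict_right_mono)
      show "{u m<..v m} \<inter> {u m'<..v m'} = {}" if "m < M" "m' < M" "m \<noteq> m'" for m m'
      proof -
        have "v i \<le> u i'" if "i < i'" "i' < M" for i i'
          using uv[of i] uv[of i'] that by (auto simp del: of_nat_Suc intro!: divide_right_mono)
        from this[of m m'] this[of m' m] that show ?thesis
          by (auto simp: not_less nat_neq_iff)
      qed
    qed
  qed (rule distribution_function_along_mono[OF G])
  with \<open>ennreal c < ?I\<close> show False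
    by simp
qed

theorem theorem2:
  fixes k :: nat and x :: "nat \<Rightarrow> real" and G :: "real \<Rightarrow> real" and N :: "nat \<Rightarrow> nat"
  assumes "k \<ge> 2"
    and "\<And>n. n \<ge> 1 \<Longrightarrow> x n \<in> {0..1}"
    and "asymptotic_distribution_function x G"
    and "distribution_function_along x N G"
  shows "(\<not> abs_continuous_on_interval 0 1 G \<longrightarrow>
            (\<forall>s::real. s > 0 \<longrightarrow>
               filterlim (\<lambda>j. correlation k x s (N j)) at_top sequentially)) \<and>
         (\<forall>g :: real \<Rightarrow> real.
            abs_continuous_on_interval 0 1 G \<and>
            (AE t in lebesgue_on {0..1}. (G has_real_derivative g t) (at t within {0..1}))
            \<longrightarrow>
            Limsup at_top (\<lambda>s::real.
                limsup (\<lambda>j. ennreal (correlation k x s (N j))) / ennreal ((2 * s) ^ (k - 1)))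
              \<ge> (\<integral>\<^sup>+ t. ennreal (g t ^ k) \<partial>lebesgue_on {0..1}))"
proof -
  \<comment> \<open>A tuple consists of a first index and \<open>q + 1\<close> neighbours;
    \<open>q\<close> is the exponent in the slope of the tangent.\<close>
  define q where "q = k - 2"
  have k: "k = Suc (Suc q)" "k - 1 = Suc q"
    using assms(1) by (auto simp: q_def)
  have "filterlim (\<lambda>j. correlation k x s (N j)) at_top sequentially"
    if "\<not> abs_continuous_on_interval 0 1 G" "s > 0" for s
    unfolding filterlim_at_top
  proof
    fix B
    \<comment> \<open>Failure of divergence would mean that some \<open>B\<close> bounds the
      correlation for infinitely many \<open>j\<close>.\<close>
    have "\<not> frequently (\<lambda>j. correlation k x s (N j) \<le> B) sequentially"
      using abs_continuous_if_frequently_bounded[OF assms(4) that(2)] that(1) unfolding k(1) by blast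
    then show "eventually (\<lambda>j. B \<le> correlation k x s (N j)) sequentially"
      unfolding not_frequently by (rule eventually_mono) simp
  qed
  then show ?thesis
    using Limsup_correlation_ge[OF assms(4)] unfolding k(2) unfolding k(1) by blast
qed

end
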